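(* Let $\mathcal{T}$, $\mathcal{S}$ be triangulated categories and let $F:\mathcal{T}\to\mathcal{S}$ be a triangulated functor with its natural isomorphism $\varphi:F\Sigma\Rightarrow\Sigma F$. If $\{B_n\}_{n\in\mathbb{N}}$ is a metric on $\mathcal{S}$, then $\{F^{-1}(B_n)\}_{n\in\mathbb{N}}$ is a metric on $\mathcal{T}$. Furthermore, if $\{B_n\}_{n\in\mathbb{N}}$ is good, so is $\{F^{-1}(B_n)\}_{n\in\mathbb{N}}$.
   Context: $\mathbb{N}=\{1,2,\dots\}$. All subcategories are full. Let $\mathcal{T}$ be a triangulated category with shift $\Sigma$. For subcategories $\mathcal{X},\mathcal{Z}\subseteq\mathcal{T}$, $\mathcal{X}*\mathcal{Z}$ is the subcategory of all objects $T$ admitting a distinguished triangle $X\to T\to Z\to\Sigma X$ with $X\in\mathcal{X}$, $Z\in\mathcal{Z}$. A metric on $\mathcal{T}$ is a non-increasing chain $B_1\supseteq B_2\supseteq\cdots$ of subcategories of $\mathcal{T}$ with $B_n*B_n=B_n$ and $0\in B_n$ for all $n$. It is good if $\Sigma^{-1}B_{n+1}\cup B_{n+1}\cup\Sigma B_{n+1}\subseteq B_n$ for all $n$. For a functor $F:\mathcal{T}\to\mathcal{S}$, $F^{-1}(B_n)$ is the subcategory of $\mathcal{T}$ of objects $X$ with $F(X)\in B_n$. *)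

theory Defs
  imports "HOL-Algebra.Group"
begin

section \<open>Categories, functors and natural isomorphisms\<close>

record ('o, 'a) cat =
  Ob :: "'o set"
  Arr :: "'a set"
  Dom :: "'a \<Rightarrow> 'o"
  Cod :: "'a \<Rightarrow> 'o"
  Ident :: "'o \<Rightarrow> 'a"
  Comp :: "'a \<Rightarrow> 'a \<Rightarrow> 'a"  (infixr "\<cdot>\<index>" 70)

definition Hom :: "('o, 'a, 'm) cat_scheme \<Rightarrow> 'o \<Rightarrow> 'o \<Rightarrow> 'a set" where
  "Hom C X Y = {f \<in> Arr C. Dom C f = X \<and> Cod C f = Y}"

locale category =
  fixes C :: "('o, 'a, 'm) cat_scheme" (structure)
  assumes Dom_Ob: "f \<in> Arr C \<Longrightarrow> Dom C f \<in> Ob C"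
    and Cod_Ob: "f \<in> Arr C \<Longrightarrow> Cod C f \<in> Ob C"
    and Ident_Hom: "X \<in> Ob C \<Longrightarrow> Ident C X \<in> Hom C X X"
    and Comp_Hom: "\<lbrakk>f \<in> Hom C X Y; g \<in> Hom C Y Z\<rbrakk> \<Longrightarrow> g \<cdot> f \<in> Hom C X Z"
    and Comp_assoc: "\<lbrakk>f \<in> Hom C W X; g \<in> Hom C X Y; h \<in> Hom C Y Z\<rbrakk>
      \<Longrightarrow> (h \<cdot> g) \<cdot> f = h \<cdot> (g \<cdot> f)"
    and Comp_Ident: "f \<in> Hom C X Y \<Longrightarrow> f \<cdot> Ident C X = f"
    and Ident_Comp: "f \<in> Hom C X Y \<Longrightarrow> Ident C Y \<cdot> f = f"

definition is_isomorphism :: "('o, 'a, 'm) cat_scheme \<Rightarrow> 'o \<Rightarrow> 'o \<Rightarrow> 'a \<Rightarrow> bool" where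
  "is_isomorphism C X Y f \<longleftrightarrow> f \<in> Hom C X Y \<and>
     (\<exists>g \<in> Hom C Y X. g \<cdot>\<^bsub>C\<^esub> f = Ident C X \<and> f \<cdot>\<^bsub>C\<^esub> g = Ident C Y)"

definition is_zero_object :: "('o, 'a, 'm) cat_scheme \<Rightarrow> 'o \<Rightarrow> bool" where
  "is_zero_object C Z \<longleftrightarrow> Z \<in> Ob C \<and>
     (\<forall>X \<in> Ob C. (\<exists>!f. f \<in> Hom C X Z) \<and> (\<exists>!f. f \<in> Hom C Z X))"

record ('o, 'a, 'p, 'b) ftr =
  fob :: "'o \<Rightarrow> 'p"
  far :: "'a \<Rightarrow> 'b"

definition is_functor ::
  "('o, 'a, 'm) cat_scheme \<Rightarrow> ('p, 'b, 'n) cat_scheme \<Rightarrow> ('o, 'a, 'p, 'b) ftr \<Rightarrow> bool" where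
  "is_functor C D F \<longleftrightarrow>
     (\<forall>X \<in> Ob C. fob F X \<in> Ob D \<and> far F (Ident C X) = Ident D (fob F X)) \<and>
     (\<forall>X \<in> Ob C. \<forall>Y \<in> Ob C. \<forall>f \<in> Hom C X Y. far F f \<in> Hom D (fob F X) (fob F Y)) \<and>
     (\<forall>X \<in> Ob C. \<forall>Y \<in> Ob C. \<forall>Z \<in> Ob C. \<forall>f \<in> Hom C X Y. \<forall>g \<in> Hom C Y Z.
        far F (g \<cdot>\<^bsub>C\<^esub> f) = far F g \<cdot>\<^bsub>D\<^esub> far F f)"

definition id_ftr :: "('o, 'a, 'o, 'a) ftr" where
  "id_ftr = \<lparr>fob = (\<lambda>X. X), far = (\<lambda>f. f)\<rparr>"

definition comp_ftr ::
  "('p, 'b, 'q, 'c) ftr \<Rightarrow> ('o, 'a, 'p, 'b) ftr \<Rightarrow> ('o, 'a, 'q, 'c) ftr" where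
  "comp_ftr G F = \<lparr>fob = (\<lambda>X. fob G (fob F X)), far = (\<lambda>f. far G (far F f))\<rparr>"

definition natural_iso ::
  "('o, 'a, 'm) cat_scheme \<Rightarrow> ('p, 'b, 'n) cat_scheme \<Rightarrow> ('o, 'a, 'p, 'b) ftr
    \<Rightarrow> ('o, 'a, 'p, 'b) ftr \<Rightarrow> ('o \<Rightarrow> 'b) \<Rightarrow> bool" where
  "natural_iso C D F G \<eta> \<longleftrightarrow>
     (\<forall>X \<in> Ob C. is_isomorphism D (fob F X) (fob G X) (\<eta> X)) \<and>
     (\<forall>X \<in> Ob C. \<forall>Y \<in> Ob C. \<forall>f \<in> Hom C X Y.
        \<eta> Y \<cdot>\<^bsub>D\<^esub> far F f = far G f \<cdot>\<^bsub>D\<^esub> \<eta> X)"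


section \<open>Additive categories\<close>

text \<open>\<open>Add\<close> is only meaningful on parallel arrows; \<open>Zero X Y\<close> is the zero arrow
  from \<open>X\<close> to \<open>Y\<close>.\<close>

record ('o, 'a) preadd_cat = "('o, 'a) cat" +
  Add :: "'a \<Rightarrow> 'a \<Rightarrow> 'a"
  Zero :: "'o \<Rightarrow> 'o \<Rightarrow> 'a"

definition hom_group :: "('o, 'a, 'm) preadd_cat_scheme \<Rightarrow> 'o \<Rightarrow> 'o \<Rightarrow> 'a monoid" where
  "hom_group C X Y = \<lparr>carrier = Hom C X Y, mult = Add C, one = Zero C X Y\<rparr>"

definition Neg :: "('o, 'a, 'm) preadd_cat_scheme \<Rightarrow> 'a \<Rightarrow> 'a" where
  "Neg C f = inv\<^bsub>hom_group C (Dom C f) (Cod C f)\<^esub> f"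

definition is_biproduct ::
  "('o, 'a, 'm) preadd_cat_scheme \<Rightarrow> 'o \<Rightarrow> 'o \<Rightarrow> 'o \<Rightarrow> 'a \<Rightarrow> 'a \<Rightarrow> 'a \<Rightarrow> 'a \<Rightarrow> bool" where
  "is_biproduct C X Y P i j p q \<longleftrightarrow>
     i \<in> Hom C X P \<and> j \<in> Hom C Y P \<and> p \<in> Hom C P X \<and> q \<in> Hom C P Y \<and>
     p \<cdot>\<^bsub>C\<^esub> i = Ident C X \<and> q \<cdot>\<^bsub>C\<^esub> j = Ident C Y \<and>
     p \<cdot>\<^bsub>C\<^esub> j = Zero C Y X \<and> q \<cdot>\<^bsub>C\<^esub> i = Zero C X Y \<and>
     Add C (i \<cdot>\<^bsub>C\<^esub> p) (j \<cdot>\<^bsub>C\<^esub> q) = Ident C P"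

locale additive_category = category C for C :: "('o, 'a, 'm) preadd_cat_scheme" (structure) +
  assumes hom_comm_group: "\<lbrakk>X \<in> Ob C; Y \<in> Ob C\<rbrakk> \<Longrightarrow> comm_group (hom_group C X Y)"
    and Comp_Add: "\<lbrakk>f \<in> Hom C X Y; f' \<in> Hom C X Y; g \<in> Hom C Y Z\<rbrakk>
      \<Longrightarrow> g \<cdot> Add C f f' = Add C (g \<cdot> f) (g \<cdot> f')"
    and Add_Comp: "\<lbrakk>f \<in> Hom C X Y; g \<in> Hom C Y Z; g' \<in> Hom C Y Z\<rbrakk>
      \<Longrightarrow> Add C g g' \<cdot> f = Add C (g \<cdot> f) (g' \<cdot> f)"
    and ex_zero_object: "\<exists>Z. is_zero_object C Z"
    and ex_biproduct: "\<lbrakk>X \<in> Ob C; Y \<in> Ob C\<rbrakk> \<Longrightarrow> \<exists>P i j p q. is_biproduct C X Y P i j p q"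

definition additive_functor ::
  "('o, 'a, 'm) preadd_cat_scheme \<Rightarrow> ('p, 'b, 'n) preadd_cat_scheme \<Rightarrow> ('o, 'a, 'p, 'b) ftr \<Rightarrow> bool" where
  "additive_functor C D F \<longleftrightarrow> is_functor C D F \<and>
     (\<forall>X \<in> Ob C. \<forall>Y \<in> Ob C.
        far F \<in> Group.hom (hom_group C X Y) (hom_group D (fob F X) (fob F Y)))"


section \<open>Triangulated categories\<close>

text \<open>The shift is an additive autoequivalence, with a chosen quasi-inverse \<open>Unshift\<close>
  interpreting \<open>\<Sigma>\<^sup>-\<^sup>1\<close>; an automorphism with its inverse is the special case in which both
  natural isomorphisms are identities. A triangle \<open>X \<rightarrow> Y \<rightarrow> Z \<rightarrow> \<Sigma>X\<close> is encoded by its three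
  arrows, which determine the objects.\<close>

record ('o, 'a) triang_cat = "('o, 'a) preadd_cat" +
  Shift :: "('o, 'a, 'o, 'a) ftr"
  Unshift :: "('o, 'a, 'o, 'a) ftr"
  Dist :: "('a \<times> 'a \<times> 'a) set"

definition triangle ::
  "('o, 'a, 'm) triang_cat_scheme \<Rightarrow> 'o \<Rightarrow> 'o \<Rightarrow> 'o \<Rightarrow> 'a \<Rightarrow> 'a \<Rightarrow> 'a \<Rightarrow> bool" where
  "triangle C X Y Z f g h \<longleftrightarrow>
     f \<in> Hom C X Y \<and> g \<in> Hom C Y Z \<and> h \<in> Hom C Z (fob (Shift C) X)"

definition dist_triangle ::
  "('o, 'a, 'm) triang_cat_scheme \<Rightarrow> 'o \<Rightarrow> 'o \<Rightarrow> 'o \<Rightarrow> 'a \<Rightarrow> 'a \<Rightarrow> 'a \<Rightarrow> bool" where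
  "dist_triangle C X Y Z f g h \<longleftrightarrow> triangle C X Y Z f g h \<and> (f, g, h) \<in> Dist C"

definition triangle_morphism ::
  "('o, 'a, 'm) triang_cat_scheme \<Rightarrow> 'a \<times> 'a \<times> 'a \<Rightarrow> 'a \<times> 'a \<times> 'a \<Rightarrow> 'a \<Rightarrow> 'a \<Rightarrow> 'a \<Rightarrow> bool" where
  "triangle_morphism C = (\<lambda>(f, g, h) (f', g', h') a b c.
     b \<cdot>\<^bsub>C\<^esub> f = f' \<cdot>\<^bsub>C\<^esub> a \<and>
     c \<cdot>\<^bsub>C\<^esub> g = g' \<cdot>\<^bsub>C\<^esub> b \<and>
     far (Shift C) a \<cdot>\<^bsub>C\<^esub> h = h' \<cdot>\<^bsub>C\<^esub> c)"

locale triangulated_category = additive_category C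
  for C :: "('o, 'a, 'm) triang_cat_scheme" (structure) +
  assumes Shift_additive: "additive_functor C C (Shift C)"
    and Unshift_functor: "is_functor C C (Unshift C)"
    and Unshift_Shift: "\<exists>\<eta>. natural_iso C C id_ftr (comp_ftr (Unshift C) (Shift C)) \<eta>"
    and Shift_Unshift: "\<exists>\<epsilon>. natural_iso C C (comp_ftr (Shift C) (Unshift C)) id_ftr \<epsilon>"
    and Dist_triangle: "(f, g, h) \<in> Dist C \<Longrightarrow> \<exists>X Y Z. triangle C X Y Z f g h"
    and TR1_iso:
      "\<lbrakk>dist_triangle C X Y Z f g h; triangle C X' Y' Z' f' g' h';
        is_isomorphism C X X' a; is_isomorphism C Y Y' b; is_isomorphism C Z Z' c;
        triangle_morphism C (f, g, h) (f', g', h') a b c\<rbrakk>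
       \<Longrightarrow> dist_triangle C X' Y' Z' f' g' h'"
    and TR1_ident:
      "\<lbrakk>X \<in> Ob C; is_zero_object C Z\<rbrakk>
       \<Longrightarrow> dist_triangle C X X Z (Ident C X) (Zero C X Z) (Zero C Z (fob (Shift C) X))"
    and TR1_cone:
      "f \<in> Hom C X Y \<Longrightarrow> \<exists>Z g h. dist_triangle C X Y Z f g h"
    and TR2:
      "triangle C X Y Z f g h \<Longrightarrow>
       dist_triangle C X Y Z f g h \<longleftrightarrow>
       dist_triangle C Y Z (fob (Shift C) X) g h (Neg C (far (Shift C) f))"
    and TR3:
      "\<lbrakk>dist_triangle C X Y Z f g h; dist_triangle C X' Y' Z' f' g' h';
        a \<in> Hom C X X'; b \<in> Hom C Y Y'; b \<cdot> f = f' \<cdot> a\<rbrakk>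
       \<Longrightarrow> \<exists>c \<in> Hom C Z Z'. triangle_morphism C (f, g, h) (f', g', h') a b c"
    and TR4:
      "\<lbrakk>dist_triangle C X Y Z' f u u';
        dist_triangle C Y Z X' g v v';
        dist_triangle C X Z Y' (g \<cdot> f) w w'\<rbrakk>
       \<Longrightarrow> \<exists>a b. dist_triangle C Z' Y' X' a b (far (Shift C) u \<cdot> v') \<and>
             a \<cdot> u = w \<cdot> g \<and> w' \<cdot> a = u' \<and>
             b \<cdot> w = v \<and> v' \<cdot> b = far (Shift C) f \<cdot> w'"

definition triangulated_functor ::
  "('o, 'a, 'm) triang_cat_scheme \<Rightarrow> ('p, 'b, 'n) triang_cat_scheme \<Rightarrow> ('o, 'a, 'p, 'b) ftr
    \<Rightarrow> ('o \<Rightarrow> 'b) \<Rightarrow> bool" where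
  "triangulated_functor T S F \<phi> \<longleftrightarrow>
     additive_functor T S F \<and>
     natural_iso T S (comp_ftr F (Shift T)) (comp_ftr (Shift S) F) \<phi> \<and>
     (\<forall>X Y Z f g h. dist_triangle T X Y Z f g h \<longrightarrow>
        dist_triangle S (fob F X) (fob F Y) (fob F Z)
          (far F f) (far F g) (\<phi> X \<cdot>\<^bsub>S\<^esub> far F h))"


section \<open>Metrics\<close>

text \<open>A full subcategory is encoded by its set of objects.\<close>

definition star :: "('o, 'a, 'm) triang_cat_scheme \<Rightarrow> 'o set \<Rightarrow> 'o set \<Rightarrow> 'o set" where
  "star C \<X> \<Z> = {T \<in> Ob C. \<exists>X \<in> \<X>. \<exists>Z \<in> \<Z>. \<exists>f g h. dist_triangle C X T Z f g h}"

text \<open>Indices start at \<open>1\<close>; the value \<open>B 0\<close> is irrelevant. Since \<open>star C (B n) (B n) = B n\<close> forces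
  \<open>B n\<close> to be closed under isomorphism once it contains some zero object, it makes no difference
  which zero object is required to lie in \<open>B n\<close>. For the same reason, the choice of quasi-inverse
  \<open>Unshift\<close> does not affect \<open>good_metric\<close>.\<close>

definition metric :: "('o, 'a, 'm) triang_cat_scheme \<Rightarrow> (nat \<Rightarrow> 'o set) \<Rightarrow> bool" where
  "metric C B \<longleftrightarrow>
     (\<forall>n\<ge>1. B n \<subseteq> Ob C \<and> B (Suc n) \<subseteq> B n \<and> star C (B n) (B n) = B n \<and>
        (\<exists>Z \<in> B n. is_zero_object C Z))"

definition good_metric :: "('o, 'a, 'm) triang_cat_scheme \<Rightarrow> (nat \<Rightarrow> 'o set) \<Rightarrow> bool" where
  "good_metric C B \<longleftrightarrow> metric C B \<and>
     (\<forall>n\<ge>1. fob (Unshift C) ` B (Suc n) \<union> B (Suc n) \<union> fob (Shift C) ` B (Suc n) \<subseteq> B n)"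

definition ftr_preimage ::
  "('o, 'a, 'm) cat_scheme \<Rightarrow> ('o, 'a, 'p, 'b) ftr \<Rightarrow> 'p set \<Rightarrow> 'o set" where
  "ftr_preimage T F \<B> = {X \<in> Ob T. fob F X \<in> \<B>}"

end

theory Submission
  imports Defs
begin

text \<open>A triangulated functor \<open>F\<close> carries zero objects to zero objects, distinguished triangles to
  distinguished triangles and commutes with the shift up to isomorphism. Pulling the axioms of a
  metric back along \<open>F\<close> is therefore straightforward, except that the data only match up to
  isomorphism: \<open>F\<close> sends a zero object to one that may differ from the one known to lie in
  \<open>B n\<close>, and \<open>F \<Sigma> X\<close> is isomorphic, not equal, to \<open>\<Sigma> F X\<close>.

  What makes the argument work is that every \<open>B n\<close> is closed under isomorphism
  (\<open>extension_closed_imp_iso_closed\<close>): an isomorphism \<open>X \<rightarrow> X'\<close> fits into a distinguished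
  triangle \<open>X \<rightarrow> X' \<rightarrow> 0 \<rightarrow> \<Sigma>X\<close>, so \<open>X' \<in> B n * B n = B n\<close>.

  For the inclusion of \<open>F\<^sup>-\<^sup>1 (B n)\<close> in \<open>F\<^sup>-\<^sup>1 (B n) * F\<^sup>-\<^sup>1 (B n)\<close>, the triangle
  \<open>X \<rightarrow> X \<rightarrow> 0 \<rightarrow> \<Sigma>X\<close> suffices; the other inclusion is \<open>F\<close> applied to a triangle. For goodness,
  \<open>\<Sigma>\<close> is handled by \<open>F \<Sigma> X \<cong> \<Sigma> F X\<close>, and \<open>\<Sigma>\<^sup>-\<^sup>1\<close> by observing that \<open>F X \<cong> \<Sigma> F \<Sigma>\<^sup>-\<^sup>1 X\<close>, so that
  \<open>\<Sigma>\<^sup>-\<^sup>1 \<Sigma> F \<Sigma>\<^sup>-\<^sup>1 X \<cong> F \<Sigma>\<^sup>-\<^sup>1 X\<close> lies in \<open>B n\<close> as soon as \<open>F X\<close> lies in \<open>B (n + 1)\<close>.\<close>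

section \<open>Isomorphic objects\<close>

definition isomorphic :: "('o, 'a, 'm) cat_scheme \<Rightarrow> 'o \<Rightarrow> 'o \<Rightarrow> bool" where
  "isomorphic C X Y \<longleftrightarrow> (\<exists>f. is_isomorphism C X Y f)"

lemma isomorphic_sym: "isomorphic C X Y \<Longrightarrow> isomorphic C Y X"
  unfolding isomorphic_def is_isomorphism_def by blast

lemma (in category) Hom_Ob:
  assumes "f \<in> Hom C X Y"
  shows "X \<in> Ob C" "Y \<in> Ob C"
  using assms Dom_Ob Cod_Ob by (auto simp: Hom_def)

lemma (in category) Ident_is_isomorphism: "X \<in> Ob C \<Longrightarrow> is_isomorphism C X X (Ident C X)"
  unfolding is_isomorphism_def using Ident_Hom Comp_Ident by blast

lemma (in category) zero_objects_isomorphic: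
  assumes Z: "is_zero_object C Z" and Z': "is_zero_object C Z'"
  shows "isomorphic C Z Z'"
proof -
  have ob: "Z \<in> Ob C" "Z' \<in> Ob C"
    using Z Z' by (auto simp: is_zero_object_def)
  obtain f where f: "f \<in> Hom C Z Z'"
    using Z ob by (auto simp: is_zero_object_def)
  obtain g where g: "g \<in> Hom C Z' Z"
    using Z' ob by (auto simp: is_zero_object_def)
  have "g \<cdot> f = Ident C Z"
    using Z ob Comp_Hom[OF f g] Ident_Hom[OF ob(1)] unfolding is_zero_object_def by blast
  moreover have "f \<cdot> g = Ident C Z'"
    using Z' ob Comp_Hom[OF g f] Ident_Hom[OF ob(2)] unfolding is_zero_object_def by blast
  ultimately show ?thesis
    using f g unfolding isomorphic_def is_isomorphism_def by blast
qed

lemma functor_preserves_isomorphic: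
  assumes C: "category C" and F: "is_functor C D F" and iso: "isomorphic C X Y"
  shows "isomorphic D (fob F X) (fob F Y)"
proof -
  interpret category C by (fact C)
  obtain f g where fg: "f \<in> Hom C X Y" "g \<in> Hom C Y X"
    "g \<cdot>\<^bsub>C\<^esub> f = Ident C X" "f \<cdot>\<^bsub>C\<^esub> g = Ident C Y"
    using iso unfolding isomorphic_def is_isomorphism_def by blast
  have ob: "X \<in> Ob C" "Y \<in> Ob C"
    using Hom_Ob[OF fg(1)] by auto
  have "far F f \<in> Hom D (fob F X) (fob F Y)" "far F g \<in> Hom D (fob F Y) (fob F X)"
    using F ob fg unfolding is_functor_def by blast+
  moreover have "far F g \<cdot>\<^bsub>D\<^esub> far F f = Ident D (fob F X)"
    using F ob fg unfolding is_functor_def by metis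
  moreover have "far F f \<cdot>\<^bsub>D\<^esub> far F g = Ident D (fob F Y)"
    using F ob fg unfolding is_functor_def by metis
  ultimately show ?thesis
    unfolding isomorphic_def is_isomorphism_def by blast
qed

section \<open>Zero arrows and zero objects\<close>

context additive_category
begin

lemma Zero_Hom:
  assumes "X \<in> Ob C" "Y \<in> Ob C"
  shows "Zero C X Y \<in> Hom C X Y"
proof -
  interpret G: comm_group "hom_group C X Y" by (rule hom_comm_group[OF assms])
  show ?thesis using G.one_closed by (simp add: hom_group_def)
qed

lemma Add_self_imp_Zero:
  assumes f: "f \<in> Hom C X Y" and ff: "Add C f f = f"
  shows "f = Zero C X Y"
proof -
  interpret G: comm_group "hom_group C X Y" by (rule hom_comm_group[OF Hom_Ob[OF f]])
  show ?thesis using G.l_cancel_one[of f f] f ff by (simp add: hom_group_def)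
qed

lemma Zero_Add_Zero:
  assumes "X \<in> Ob C" "Y \<in> Ob C"
  shows "Add C (Zero C X Y) (Zero C X Y) = Zero C X Y"
proof -
  interpret G: comm_group "hom_group C X Y" by (rule hom_comm_group[OF assms])
  show ?thesis using G.l_one[OF G.one_closed] by (simp add: hom_group_def)
qed

lemma Zero_Comp:
  assumes f: "f \<in> Hom C X Y" and Z: "Z \<in> Ob C"
  shows "Zero C Y Z \<cdot> f = Zero C X Z"
proof (rule Add_self_imp_Zero)
  have z: "Zero C Y Z \<in> Hom C Y Z" using Zero_Hom[OF Hom_Ob(2)[OF f] Z] .
  show "Zero C Y Z \<cdot> f \<in> Hom C X Z" by (rule Comp_Hom[OF f z])
  show "Add C (Zero C Y Z \<cdot> f) (Zero C Y Z \<cdot> f) = Zero C Y Z \<cdot> f"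
    using Add_Comp[OF f z z] Zero_Add_Zero[OF Hom_Ob(2)[OF f] Z] by simp
qed

lemma Comp_Zero:
  assumes f: "f \<in> Hom C Y Z" and X: "X \<in> Ob C"
  shows "f \<cdot> Zero C X Y = Zero C X Z"
proof (rule Add_self_imp_Zero)
  have z: "Zero C X Y \<in> Hom C X Y" using Zero_Hom[OF X Hom_Ob(1)[OF f]] .
  show "f \<cdot> Zero C X Y \<in> Hom C X Z" by (rule Comp_Hom[OF z f])
  show "Add C (f \<cdot> Zero C X Y) (f \<cdot> Zero C X Y) = f \<cdot> Zero C X Y"
    using Comp_Add[OF z z f] Zero_Add_Zero[OF X Hom_Ob(1)[OF f]] by simp
qed

text \<open>The universal property of a zero object quantifies over all objects, which a functor may fail
  to reach. The equation \<open>1 = 0\<close> involves only \<open>Z\<close> itself and is visibly preserved by additive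
  functors.\<close>

lemma is_zero_object_iff_Ident_eq_Zero:
  "is_zero_object C Z \<longleftrightarrow> Z \<in> Ob C \<and> Ident C Z = Zero C Z Z"
proof (intro iffI conjI)
  assume Z: "is_zero_object C Z"
  then show ob: "Z \<in> Ob C" by (simp add: is_zero_object_def)
  show "Ident C Z = Zero C Z Z"
    using Z ob Ident_Hom[OF ob] Zero_Hom[OF ob ob] unfolding is_zero_object_def by blast
next
  assume Z: "Z \<in> Ob C \<and> Ident C Z = Zero C Z Z"
  have "f = Zero C X Z" if "f \<in> Hom C X Z" for f X
    using Ident_Comp[OF that] Zero_Comp[OF that] Z by simp
  moreover have "f = Zero C Z X" if "f \<in> Hom C Z X" for f X
    using Comp_Ident[OF that] Comp_Zero[OF that] Z by simp
  ultimately show "is_zero_object C Z"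
    unfolding is_zero_object_def using Z Zero_Hom by blast
qed

end

lemma additive_functor_preserves_zero_object:
  assumes C: "additive_category C" and D: "additive_category D"
    and F: "additive_functor C D F" and Z: "is_zero_object C Z"
  shows "is_zero_object D (fob F Z)"
proof -
  interpret C: additive_category C by (fact C)
  interpret D: additive_category D by (fact D)
  have Z_Ob: "Z \<in> Ob C" and Z_eq: "Ident C Z = Zero C Z Z"
    using Z by (auto simp: C.is_zero_object_iff_Ident_eq_Zero)
  have FZ: "fob F Z \<in> Ob D" and F_id: "far F (Ident C Z) = Ident D (fob F Z)"
    using F Z_Ob by (auto simp: additive_functor_def is_functor_def)
  interpret G: comm_group "hom_group C Z Z" by (rule C.hom_comm_group[OF Z_Ob Z_Ob])
  interpret H: comm_group "hom_group D (fob F Z) (fob F Z)" by (rule D.hom_comm_group[OF FZ FZ])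
  have "far F \<in> Group.hom (hom_group C Z Z) (hom_group D (fob F Z) (fob F Z))"
    using F Z_Ob by (auto simp: additive_functor_def)
  from hom_one[OF this G.is_group H.is_group]
  have "far F (Zero C Z Z) = Zero D (fob F Z) (fob F Z)"
    by (simp add: hom_group_def)
  with F_id FZ Z_eq show ?thesis
    by (simp add: D.is_zero_object_iff_Ident_eq_Zero)
qed

section \<open>Closure of metrics under isomorphism\<close>

text \<open>The triangle \<open>X \<rightarrow> X' \<rightarrow> 0 \<rightarrow> \<Sigma>X\<close> on an isomorphism is a copy of the trivial triangle
  \<open>X \<rightarrow> X \<rightarrow> 0 \<rightarrow> \<Sigma>X\<close> on the identity of \<open>X\<close>.\<close>

lemma (in triangulated_category) extension_closed_imp_iso_closed:
  assumes ext: "star C \<B> \<B> \<subseteq> \<B>"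
    and Z: "Z \<in> \<B>" "is_zero_object C Z"
    and X: "X \<in> \<B>" and iso: "isomorphic C X X'"
  shows "X' \<in> \<B>"
proof -
  obtain a where a: "is_isomorphism C X X' a"
    using iso unfolding isomorphic_def by blast
  then have a_Hom: "a \<in> Hom C X X'" by (simp add: is_isomorphism_def)
  have ob: "X \<in> Ob C" "X' \<in> Ob C" using Hom_Ob[OF a_Hom] by auto
  have Z_Ob: "Z \<in> Ob C" using Z by (simp add: is_zero_object_def)
  let ?z = "Zero C Z (fob (Shift C) X)"
  have triv: "dist_triangle C X X Z (Ident C X) (Zero C X Z) ?z"
    by (rule TR1_ident[OF ob(1) Z(2)])
  then have z: "?z \<in> Hom C Z (fob (Shift C) X)"
    by (simp add: dist_triangle_def triangle_def)
  have tri: "triangle C X X' Z a (Zero C X' Z) ?z"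
    using a_Hom z Zero_Hom[OF ob(2) Z_Ob] by (simp add: triangle_def)
  have shift_id: "far (Shift C) (Ident C X) = Ident C (fob (Shift C) X)"
    using Shift_additive ob(1) by (simp add: additive_functor_def is_functor_def)
  have "triangle_morphism C (Ident C X, Zero C X Z, ?z) (a, Zero C X' Z, ?z)
      (Ident C X) a (Ident C Z)"
    using Ident_Comp[OF Zero_Hom[OF ob(1) Z_Ob]] Zero_Comp[OF a_Hom Z_Ob]
      Ident_Comp[OF z] Comp_Ident[OF z]
    by (simp add: triangle_morphism_def shift_id)
  from TR1_iso[OF triv tri Ident_is_isomorphism[OF ob(1)] a Ident_is_isomorphism[OF Z_Ob] this]
  have "X' \<in> star C \<B> \<B>"
    unfolding star_def using X Z(1) ob(2) by blast
  with ext show ?thesis by blast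
qed

lemma (in triangulated_category) metric_iso_closed:
  assumes "metric C B" "n \<ge> 1" "X \<in> B n" "isomorphic C X X'"
  shows "X' \<in> B n"
  using assms extension_closed_imp_iso_closed[of "B n"] unfolding metric_def by blast

section \<open>Preimages of metrics\<close>

lemma natural_iso_imp_isomorphic:
  assumes "natural_iso C D F G \<eta>" "X \<in> Ob C"
  shows "isomorphic D (fob F X) (fob G X)"
  using assms unfolding natural_iso_def isomorphic_def by blast

lemma triangulated_functor_commutes_Shift:
  assumes "triangulated_functor T S F \<phi>" "X \<in> Ob T"
  shows "isomorphic S (fob F (fob (Shift T) X)) (fob (Shift S) (fob F X))"
  using natural_iso_imp_isomorphic[of T S "comp_ftr F (Shift T)" "comp_ftr (Shift S) F" \<phi> X] assms
  by (simp add: triangulated_functor_def comp_ftr_def)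

lemma metric_ftr_preimage:
  assumes T: "triangulated_category T" and S: "triangulated_category S"
    and F: "triangulated_functor T S F \<phi>" and B: "metric S B"
  shows "metric T (\<lambda>n. ftr_preimage T F (B n))"
proof -
  interpret T: triangulated_category T by (fact T)
  interpret S: triangulated_category S by (fact S)
  have F_add: "additive_functor T S F"
    using F by (simp add: triangulated_functor_def)
  obtain Z where Z: "is_zero_object T Z"
    using T.ex_zero_object by blast
  have Z_Ob: "Z \<in> Ob T" using Z by (simp add: is_zero_object_def)
  have FZ: "is_zero_object S (fob F Z)"
    by (rule additive_functor_preserves_zero_object
        [OF T.additive_category_axioms S.additive_category_axioms F_add Z])
  have zero_mem: "Z \<in> ftr_preimage T F (B n)" if n: "n \<ge> 1" for n
  proof -
    obtain Z' where Z': "Z' \<in> B n" "is_zero_object S Z'"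
      using B n unfolding metric_def by blast
    from S.metric_iso_closed[OF B n Z'(1) S.zero_objects_isomorphic[OF Z'(2) FZ]]
    show ?thesis using Z_Ob by (simp add: ftr_preimage_def)
  qed
  have star_le: "star T (ftr_preimage T F (B n)) (ftr_preimage T F (B n)) \<subseteq> ftr_preimage T F (B n)"
    if n: "n \<ge> 1" for n
  proof
    fix Y assume "Y \<in> star T (ftr_preimage T F (B n)) (ftr_preimage T F (B n))"
    then obtain X W f g h where Y: "Y \<in> Ob T" and XW: "fob F X \<in> B n" "fob F W \<in> B n"
      and tri: "dist_triangle T X Y W f g h"
      unfolding star_def ftr_preimage_def by blast
    have "dist_triangle S (fob F X) (fob F Y) (fob F W) (far F f) (far F g) (\<phi> X \<cdot>\<^bsub>S\<^esub> far F h)"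
      using F tri unfolding triangulated_functor_def by blast
    moreover have "fob F Y \<in> Ob S"
      using F_add Y by (simp add: additive_functor_def is_functor_def)
    ultimately have "fob F Y \<in> star S (B n) (B n)"
      unfolding star_def using XW by blast
    then show "Y \<in> ftr_preimage T F (B n)"
      using B n Y unfolding metric_def ftr_preimage_def by blast
  qed
  have star_ge: "ftr_preimage T F (B n) \<subseteq> star T (ftr_preimage T F (B n)) (ftr_preimage T F (B n))"
    if n: "n \<ge> 1" for n
  proof
    fix X assume X: "X \<in> ftr_preimage T F (B n)"
    then have X_Ob: "X \<in> Ob T" by (simp add: ftr_preimage_def)
    show "X \<in> star T (ftr_preimage T F (B n)) (ftr_preimage T F (B n))"
      unfolding star_def using X X_Ob zero_mem[OF n] T.TR1_ident[OF X_Ob Z] by blast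
  qed
  have decreasing: "ftr_preimage T F (B (Suc n)) \<subseteq> ftr_preimage T F (B n)" if "n \<ge> 1" for n
    using B that unfolding metric_def ftr_preimage_def by blast
  have objects: "ftr_preimage T F (B n) \<subseteq> Ob T" for n
    by (auto simp: ftr_preimage_def)
  show ?thesis
    unfolding metric_def
  proof (intro allI impI conjI)
    fix n :: nat assume n: "1 \<le> n"
    show "star T (ftr_preimage T F (B n)) (ftr_preimage T F (B n)) = ftr_preimage T F (B n)"
      using star_le[OF n] star_ge[OF n] by (rule subset_antisym)
    show "\<exists>Z\<in>ftr_preimage T F (B n). is_zero_object T Z"
      using zero_mem[OF n] Z by blast
  qed (use decreasing objects in auto)
qed

lemma good_metric_ftr_preimage:
  assumes T: "triangulated_category T" and S: "triangulated_category S"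
    and F: "triangulated_functor T S F \<phi>" and B: "good_metric S B"
  shows "good_metric T (\<lambda>n. ftr_preimage T F (B n))"
proof -
  interpret T: triangulated_category T by (fact T)
  interpret S: triangulated_category S by (fact S)
  have F_ftr: "is_functor T S F"
    using F by (simp add: triangulated_functor_def additive_functor_def)
  have metric_B: "metric S B" using B by (simp add: good_metric_def)
  have metric_pre: "metric T (\<lambda>n. ftr_preimage T F (B n))"
    by (rule metric_ftr_preimage[OF T S F metric_B])
  have B_Shift: "fob (Shift S) Y \<in> B n" and B_Unshift: "fob (Unshift S) Y \<in> B n"
    if "n \<ge> 1" "Y \<in> B (Suc n)" for n Y
    using B that unfolding good_metric_def by blast+
  have Shift_mem: "fob (Shift T) X \<in> ftr_preimage T F (B n)"
    if n: "n \<ge> 1" and X: "X \<in> ftr_preimage T F (B (Suc n))" for n X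
  proof -
    have X_Ob: "X \<in> Ob T" and FX: "fob F X \<in> B (Suc n)"
      using X by (auto simp: ftr_preimage_def)
    have "fob F (fob (Shift T) X) \<in> B n"
      by (rule S.metric_iso_closed[OF metric_B n B_Shift[OF n FX]
            isomorphic_sym[OF triangulated_functor_commutes_Shift[OF F X_Ob]]])
    moreover have "fob (Shift T) X \<in> Ob T"
      using T.Shift_additive X_Ob by (simp add: additive_functor_def is_functor_def)
    ultimately show ?thesis by (simp add: ftr_preimage_def)
  qed
  have Unshift_mem: "fob (Unshift T) X \<in> ftr_preimage T F (B n)"
    if n: "n \<ge> 1" and X: "X \<in> ftr_preimage T F (B (Suc n))" for n X
  proof -
    have X_Ob: "X \<in> Ob T" and FX: "fob F X \<in> B (Suc n)"
      using X by (auto simp: ftr_preimage_def)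
    let ?U = "fob (Unshift T) X"
    have U_Ob: "?U \<in> Ob T"
      using T.Unshift_functor X_Ob by (simp add: is_functor_def)
    have FU_Ob: "fob F ?U \<in> Ob S"
      using F_ftr U_Ob by (simp add: is_functor_def)
    obtain \<epsilon> where \<epsilon>: "natural_iso T T (comp_ftr (Shift T) (Unshift T)) id_ftr \<epsilon>"
      using T.Shift_Unshift by (rule exE)
    \<comment> \<open>Compatibility with \<open>\<Sigma>\<close> is given, with \<open>\<Sigma>\<^sup>-\<^sup>1\<close> it is not; so \<open>X\<close> is first written as a shift.\<close>
    have "isomorphic T (fob (Shift T) ?U) X"
      using natural_iso_imp_isomorphic[OF \<epsilon> X_Ob] by (simp add: comp_ftr_def id_ftr_def)
    then have "isomorphic S (fob F X) (fob F (fob (Shift T) ?U))"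
      by (rule functor_preserves_isomorphic[OF T.category_axioms F_ftr isomorphic_sym])
    then have "fob F (fob (Shift T) ?U) \<in> B (Suc n)"
      by (rule S.metric_iso_closed[OF metric_B _ FX, rotated]) simp
    then have "fob (Shift S) (fob F ?U) \<in> B (Suc n)"
      by (rule S.metric_iso_closed[OF metric_B _ _
            triangulated_functor_commutes_Shift[OF F U_Ob], rotated]) simp
    then have "fob (Unshift S) (fob (Shift S) (fob F ?U)) \<in> B n"
      by (rule B_Unshift[OF n])
    moreover obtain \<eta> where \<eta>: "natural_iso S S id_ftr (comp_ftr (Unshift S) (Shift S)) \<eta>"
      using S.Unshift_Shift by (rule exE)
    \<comment> \<open>Having produced a shift inside \<open>B (n + 1)\<close>, \<open>\<Sigma>\<^sup>-\<^sup>1\<close> of \<open>S\<close> can be cancelled against it.\<close>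
    have "isomorphic S (fob (Unshift S) (fob (Shift S) (fob F ?U))) (fob F ?U)"
      by (rule isomorphic_sym)
        (use natural_iso_imp_isomorphic[OF \<eta> FU_Ob] in \<open>simp add: comp_ftr_def id_ftr_def\<close>)
    ultimately have "fob F ?U \<in> B n"
      using S.metric_iso_closed[OF metric_B n] by blast
    with U_Ob show ?thesis by (simp add: ftr_preimage_def)
  qed
  have decreasing: "ftr_preimage T F (B (Suc n)) \<subseteq> ftr_preimage T F (B n)" if "n \<ge> 1" for n
    using metric_pre that by (simp add: metric_def)
  show ?thesis
    unfolding good_metric_def using metric_pre Shift_mem Unshift_mem decreasing by blast
qed

theorem lemma4p12:
  fixes T :: "('o, 'a, 'm) triang_cat_scheme"
    and S :: "('p, 'b, 'n) triang_cat_scheme"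
    and F :: "('o, 'a, 'p, 'b) ftr"
    and \<phi> :: "'o \<Rightarrow> 'b"
    and B :: "nat \<Rightarrow> 'p set"
  assumes "triangulated_category T"
    and "triangulated_category S"
    and "triangulated_functor T S F \<phi>"
  shows "(metric S B \<longrightarrow> metric T (\<lambda>n. ftr_preimage T F (B n))) \<and>
         (good_metric S B \<longrightarrow> good_metric T (\<lambda>n. ftr_preimage T F (B n)))"
  using metric_ftr_preimage[OF assms] good_metric_ftr_preimage[OF assms] by blast

end
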